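(* Let $N$ be prime and let $k$ be a positive integer with $2k+1<N$. Let $v=\chi_{[0,k]}\in\mathbb{C}^N$ (a window of length $k+1$) be the characteristic function of $\{0,1,\dots,k\}\subseteq\mathbb{Z}_N$, and let $g\in\mathbb{C}^N$ be defined by $\hat g=v$. Then for each $p\in\mathbb{Z}_N$ the sequence $c_p=(\langle g,g_{p,\ell}\rangle)_{\ell\in\mathbb{Z}_N}$ satisfies $$2k\le\|c_p\|_0\le \hat k\quad\text{with }\hat k=2k+1,$$ and therefore $(2k+1)\min(4k^2-2k+1,N)$ measurements from the Gabor frame $(g_\lambda)_{\lambda\in\mathbb{Z}_N^2}$ with $g$ as generator will do $k$-sparse phase retrieval.
   Context: Vectors in $\mathbb{C}^N$ are indexed by $\mathbb{Z}_N=\mathbb{Z}/N\mathbb{Z}$; $\omega=e^{2\pi i/N}$. $\|f\|_0$ is the number of non-zero entries of $f$, and $\hat f(j)=\sum_{n=0}^{N-1}f(n)\omega^{-nj}$ is the discrete Fourier transform. The scalar product is $\langle x,y\rangle=\sum_{j\in\mathbb{Z}_N}\overline{x(j)}\,y(j)$. Translations and modulations are $(T_px)(n)=x(n-p)$ and $(M_\ell x)(n)=\omega^{\ell n}x(n)$. For $\lambda=(p,\ell)\in\mathbb{Z}_N^2$ put $g_\lambda=g_{p,\ell}=M_\ell T_pg$. The measurements of $x$ are the numbers $|\langle x,g_\lambda\rangle|^2$. Let $\mathbb{T}=\{c\in\mathbb{C}:|c|=1\}$ and $\mathcal{C}_k=\{x\in\mathbb{C}^N:\|x\|_0\le k\}$.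 A system $(g_\lambda)_{\lambda\in\Lambda}$, $\Lambda\subseteq\mathbb{Z}_N^2$, does (allows) $k$-sparse phase retrieval if, whenever $x,y\in\mathcal{C}_k$ satisfy $|\langle x,g_\lambda\rangle|=|\langle y,g_\lambda\rangle|$ for all $\lambda\in\Lambda$, there is $c\in\mathbb{T}$ with $x=cy$. *)

theory Defs
  imports Complex_Main "HOL-Computational_Algebra.Primes"
begin

text \<open>
  A vector in \<open>\<complex>\<^sup>N\<close> indexed by \<open>\<int>/N\<int>\<close> is represented as an \<open>N\<close>-periodic function on the
  integers, so that index arithmetic modulo \<open>N\<close> is ordinary integer arithmetic and equality of
  vectors is equality of functions. Sums and counts range over the representatives \<open>0, \<dots>, N - 1\<close>.
\<close>

definition residues_mod :: "nat \<Rightarrow> int set" where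
  "residues_mod N = {0..<int N}"

definition cyclic_vectors :: "nat \<Rightarrow> (int \<Rightarrow> complex) set" where
  "cyclic_vectors N = {x. \<forall>n. x (n + int N) = x n}"

definition omega :: "nat \<Rightarrow> complex" where
  "omega N = exp (2 * of_real pi * \<i> / of_nat N)"

definition l0_norm :: "nat \<Rightarrow> (int \<Rightarrow> complex) \<Rightarrow> nat" where
  "l0_norm N x = card {n \<in> residues_mod N. x n \<noteq> 0}"

definition dft :: "nat \<Rightarrow> (int \<Rightarrow> complex) \<Rightarrow> (int \<Rightarrow> complex)" where
  "dft N f = (\<lambda>j. \<Sum>n\<in>residues_mod N. f n * omega N powi (- (n * j)))"

text \<open>The scalar product is conjugate-linear in its first argument.\<close>

definition scalar_prod :: "nat \<Rightarrow> (int \<Rightarrow> complex) \<Rightarrow> (int \<Rightarrow> complex) \<Rightarrow> complex" where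
  "scalar_prod N x y = (\<Sum>j\<in>residues_mod N. cnj (x j) * y j)"

definition translation :: "int \<Rightarrow> (int \<Rightarrow> complex) \<Rightarrow> (int \<Rightarrow> complex)" where
  "translation p x = (\<lambda>n. x (n - p))"

definition modulation :: "nat \<Rightarrow> int \<Rightarrow> (int \<Rightarrow> complex) \<Rightarrow> (int \<Rightarrow> complex)" where
  "modulation N l x = (\<lambda>n. omega N powi (l * n) * x n)"

definition gabor :: "nat \<Rightarrow> (int \<Rightarrow> complex) \<Rightarrow> int \<times> int \<Rightarrow> (int \<Rightarrow> complex)" where
  "gabor N g = (\<lambda>(p, l). modulation N l (translation p g))"

text \<open>The characteristic function of the residue classes of \<open>0, \<dots>, k\<close> (for \<open>k < N\<close>).\<close>

definition interval_window :: "nat \<Rightarrow> nat \<Rightarrow> (int \<Rightarrow> complex)" where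
  "interval_window N k = (\<lambda>n. if n mod int N \<in> {0..int k} then 1 else 0)"

definition sparse_vectors :: "nat \<Rightarrow> nat \<Rightarrow> (int \<Rightarrow> complex) set" where
  "sparse_vectors N k = {x \<in> cyclic_vectors N. l0_norm N x \<le> k}"

definition does_sparse_phase_retrieval ::
    "nat \<Rightarrow> nat \<Rightarrow> ('i \<Rightarrow> int \<Rightarrow> complex) \<Rightarrow> 'i set \<Rightarrow> bool" where
  "does_sparse_phase_retrieval N k \<phi> \<Lambda> \<longleftrightarrow>
     (\<forall>x\<in>sparse_vectors N k. \<forall>y\<in>sparse_vectors N k.
        (\<forall>i\<in>\<Lambda>. cmod (scalar_prod N x (\<phi> i)) = cmod (scalar_prod N y (\<phi> i))) \<longrightarrow>
        (\<exists>c. cmod c = 1 \<and> x = (\<lambda>n. c * y n)))"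

end

theory Submission
  imports Defs "HOL-Computational_Algebra.Polynomial"
begin

text \<open>
  On the Fourier side a Gabor measurement only sees a short window. Since \<open>g\<close> is the inverse
  transform of the indicator of \<open>{0..k}\<close>, lemma \<open>scalar_prod_gabor_interval\<close> gives, up to the
  factor \<open>1/N\<close>,
  \<open>\<langle>x, g\<^sub>p\<^sub>,\<^sub>l\<rangle> = \<Sum>b\<in>{0..k}. \<omega>\<^sup>-\<^sup>p\<^sup>b * cnj (X (l + b))\<close>, where \<open>X\<close> is the transform of \<open>x\<close>.
  For \<open>x = g\<close> the summand is supported on those \<open>b\<close> for which \<open>l + b\<close> falls back into the window.
  This is an interval of at most \<open>k + 1\<close> indices, nonempty exactly if \<open>l\<close> is congruent to an element of
  \<open>{-k..k}\<close>. A sum of at least one and fewer than \<open>N\<close> consecutive powers of a root of unity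
  \<open>\<omega>\<^sup>s\<close> never vanishes when \<open>N\<close> is prime, so \<open>c\<^sub>p\<close> has exactly \<open>2k + 1\<close> non-zero entries.

  For phase retrieval, measure at \<open>p \<in> {0..2k}\<close> and \<open>l \<in> {0..<m}\<close> with
  \<open>m = min (4k\<^sup>2 - 2k + 1) N\<close>, and let \<open>x\<close> and \<open>y\<close>, with transforms \<open>X\<close> and \<open>Y\<close>, be two
  \<open>k\<close>-sparse vectors with the same measurements. A Vandermonde argument
  (\<open>fibre_sum_eq_0_if_power_sums_eq_0\<close>) is used in three ways.

  \<^item> For fixed \<open>l\<close> the squared measurement is a trigonometric polynomial in \<open>p\<close> with the
    \<open>2k + 1\<close> frequencies \<open>-k, \<dots>, k\<close>. So \<open>2k + 1\<close> values of \<open>p\<close> determine its coefficients, the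
    windowed autocorrelations of \<open>X\<close> (\<open>window_correlations_eq\<close>).
  \<^item> For a fixed lag \<open>d \<in> {0..k}\<close> these are, as functions of \<open>l\<close>, moving sums of
    \<open>j \<mapsto> cnj (X j) * X (j + d)\<close>. This product is an exponential sum whose frequencies are differences
    of elements of the support of \<open>x\<close>, and passing to a moving sum multiplies each coefficient by a
    sum of consecutive powers, which is non-zero. The vectors \<open>x\<close> and \<open>y\<close> together contribute at most
    \<open>min (2k\<^sup>2) N \<le> m\<close> frequencies, so the values at \<open>l < m\<close> determine \<open>cnj (X j) * X (j + d)\<close> for
    every \<open>j\<close> (\<open>sparse_correlations_eq\<close>).
  \<^item> The transform of a non-zero \<open>k\<close>-sparse vector cannot vanish at \<open>k\<close> consecutive points
    (\<open>eq_0_if_dft_eq_0_on_window\<close>). So the non-zero values of \<open>X\<close> are linked by steps of length at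
    most \<open>k\<close>, and along such a step the product \<open>cnj (X j) * X (j + d)\<close> carries the
    relative phase: \<open>X = c * Y\<close> with a single unimodular \<open>c\<close> (\<open>phase_propagation\<close>), hence
    \<open>x = c * y\<close>.
\<close>

section \<open>Power sums\<close>

text \<open>
  Non-singularity of the Vandermonde matrix, with coefficients that share a node collected rather
  than assumed to have distinct nodes. The vanishing of the first \<open>m\<close> power sums extends linearly
  to all polynomials of degree below \<open>m\<close>; the Lagrange polynomial of \<open>z\<close> isolates its fibre.
\<close>

lemma fibre_sum_eq_0_if_power_sums_eq_0:
  fixes e c :: "'i \<Rightarrow> 'a :: idom"
  assumes I: "finite I" and card: "card (e ` I) \<le> m"
    and zero: "\<And>l. l < m \<Longrightarrow> (\<Sum>i\<in>I. c i * e i ^ l) = 0"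
  shows "(\<Sum>i\<in>{i\<in>I. e i = z}. c i) = 0"
proof (cases "z \<in> e ` I")
  case False
  then have "{i\<in>I. e i = z} = {}" by auto
  then show ?thesis by (simp only: sum.empty)
next
  case True
  define q where "q = (\<Prod>w\<in>e ` I - {z}. [:- w, 1:])"
  have fin: "finite (e ` I - {z})" using I by simp
  have "degree q \<le> (\<Sum>w\<in>e ` I - {z}. degree [:- w, 1:])"
    unfolding q_def by (rule degree_prod_sum_le[OF fin, unfolded o_def])
  also have "\<dots> = card (e ` I) - 1" using True I by simp
  also have "\<dots> < m"
    using card True I by (metis card_gt_0_iff diff_less empty_iff finite_imageI less_le_trans zero_less_one)
  finally have deg: "degree q < m" .
  have q_eq: "poly q (e i) = (if e i = z then poly q z else 0)" if "i \<in> I" for i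
    using that I by (auto simp: q_def poly_prod)
  have qz: "poly q z \<noteq> 0" using fin by (auto simp: q_def poly_prod)
  have "(\<Sum>i\<in>I. c i * poly q (e i)) = (\<Sum>i\<in>I. \<Sum>l\<le>degree q. coeff q l * (c i * e i ^ l))"
    by (simp add: poly_altdef sum_distrib_left mult_ac)
  also have "\<dots> = (\<Sum>l\<le>degree q. coeff q l * (\<Sum>i\<in>I. c i * e i ^ l))"
    by (subst sum.swap) (simp add: sum_distrib_left)
  also have "\<dots> = 0" using deg zero by (intro sum.neutral) simp
  finally have "0 = (\<Sum>i\<in>I. c i * poly q (e i))" by simp
  also have "\<dots> = (\<Sum>i\<in>I. if e i = z then c i * poly q z else 0)"
    by (intro sum.cong) (auto simp: q_eq)
  also have "\<dots> = (\<Sum>i\<in>{i\<in>I. e i = z}. c i * poly q z)"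
    using I by (simp add: sum.inter_filter)
  finally show ?thesis using qz by (simp flip: sum_distrib_right)
qed

section \<open>Roots of unity\<close>

lemma omega_powi_eq_cis: "omega N powi a = cis (2 * pi * of_int a / of_nat N)"
proof -
  have "omega N = cis (2 * pi / of_nat N)"
    by (simp add: omega_def cis_conv_exp mult_ac)
  then show ?thesis by (simp add: cis_power_int mult_ac)
qed

lemma omega_neq_0 [simp]: "omega N \<noteq> 0"
  by (simp add: omega_def)

lemma omega_powi_add: "omega N powi (a + b) = omega N powi a * omega N powi b"
  by (simp add: power_int_add)

lemma cnj_omega_powi: "cnj (omega N powi a) = omega N powi (- a)"
  by (simp add: omega_powi_eq_cis cis_cnj)

lemma omega_powi_mult_nat: "omega N powi (a * int n) = (omega N powi a) ^ n"
  by (rule power_int_power'[symmetric])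

lemma omega_powi_eq_1_iff:
  assumes "N > 0"
  shows "omega N powi a = 1 \<longleftrightarrow> int N dvd a"
proof
  assume "omega N powi a = 1"
  then have "cos (2 * pi * of_int a / of_nat N) = 1"
    by (auto simp: omega_powi_eq_cis complex_eq_iff)
  then obtain n :: int where "2 * pi * of_int a / of_nat N = of_int n * 2 * pi"
    unfolding cos_one_2pi_int by blast
  then have "real_of_int a = real_of_int (n * int N)"
    using assms by (simp add: field_simps)
  then have "a = n * int N" by (simp only: of_int_eq_iff)
  then show "int N dvd a" by simp
next
  assume "int N dvd a"
  then obtain n where "a = int N * n" by blast
  then have "2 * pi * of_int a / of_nat N = 2 * pi * of_int n" using assms by simp
  then show "omega N powi a = 1" unfolding omega_powi_eq_cis by (simp only: cis_multiple_2pi Ints_of_int)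
qed

lemma omega_powi_eq_iff:
  assumes "N > 0"
  shows "omega N powi a = omega N powi b \<longleftrightarrow> int N dvd a - b"
proof -
  have "omega N powi a = omega N powi (a - b) * omega N powi b"
    by (simp flip: omega_powi_add)
  then have "omega N powi a = omega N powi b \<longleftrightarrow> omega N powi (a - b) = 1"
    by simp
  then show ?thesis by (simp add: omega_powi_eq_1_iff[OF assms])
qed

lemma omega_powi_inj:
  assumes "\<bar>a - b\<bar> < int N" "omega N powi a = omega N powi b"
  shows "a = b"
proof -
  have "int N dvd a - b" using assms by (subst omega_powi_eq_iff[symmetric]) auto
  then show ?thesis using assms(1) by (metis dvd_imp_le_int eq_iff_diff_eq_0 not_less abs_of_nat)
qed

lemma sum_omega_powi_consecutive:
  assumes "omega N powi s \<noteq> 1"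
  shows "(\<Sum>b\<in>{u..<u + int r}. omega N powi (s * b)) =
    omega N powi (s * u) * (omega N powi (s * int r) - 1) / (omega N powi s - 1)"
proof -
  have img: "{u..<u + int r} = (\<lambda>i. u + int i) ` {..<r}"
    by (auto simp: image_iff intro!: bexI[of _ "nat (x - u)" for x])
  have "(\<Sum>b\<in>{u..<u + int r}. omega N powi (s * b)) =
      (\<Sum>i<r. omega N powi (s * u) * (omega N powi s) ^ i)"
    unfolding img
    by (subst sum.reindex) (auto simp: inj_on_def ring_distribs omega_powi_add omega_powi_mult_nat)
  then show ?thesis
    using assms by (simp add: geometric_sum omega_powi_mult_nat flip: sum_distrib_left)
qed

text \<open>
  Primality enters here: by the geometric sum formula, the sum could vanish only if
  \<open>N\<close> divided \<open>s * r\<close>.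
\<close>

lemma sum_omega_powi_consecutive_neq_0:
  assumes N: "prime N" and r: "0 < r" "r < N"
  shows "(\<Sum>b\<in>{u..<u + int r}. omega N powi (s * b)) \<noteq> 0"
proof (cases "omega N powi s = 1")
  case True
  then have "omega N powi (s * b) = 1" for b by (simp add: power_int_mult)
  then show ?thesis using r by simp
next
  case False
  have N0: "N > 0" using r by simp
  have "\<not> int N dvd s" using False omega_powi_eq_1_iff[OF N0] by simp
  moreover have "\<not> int N dvd int r" using r by (simp add: nat_dvd_not_less)
  ultimately have "\<not> int N dvd s * int r"
    using N by (simp add: prime_dvd_mult_iff)
  then show ?thesis
    using False by (simp add: sum_omega_powi_consecutive omega_powi_eq_1_iff[OF N0])
qed

section \<open>The discrete Fourier transform\<close>

lemma cyclic_vectors_mod: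
  assumes "f \<in> cyclic_vectors N"
  shows "f (n mod int N) = f n"
proof -
  have shift: "f (n + int t * int N) = f n" for n t
  proof (induction t)
    case (Suc t)
    have "f (n + int (Suc t) * int N) = f ((n + int t * int N) + int N)"
      by (simp add: algebra_simps)
    then show ?case using assms Suc by (simp add: cyclic_vectors_def)
  qed simp
  define q where "q = n div int N"
  have n: "n = n mod int N + q * int N" by (simp add: q_def)
  show ?thesis
  proof (cases "q \<ge> 0")
    case True
    then show ?thesis using shift[of "n mod int N" "nat q"] n by simp
  next
    case False
    then show ?thesis using shift[of n "nat (- q)"] by (simp add: q_def minus_div_mult_eq_mod)
  qed
qed

lemma finite_residues_mod [simp]: "finite (residues_mod N)"
  by (simp add: residues_mod_def)

lemma card_residues_mod [simp]: "card (residues_mod N) = N"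
  by (simp add: residues_mod_def)

lemma l0_norm_le: "l0_norm N f \<le> N"
  unfolding l0_norm_def by (rule order_trans[OF card_mono[of "residues_mod N"]]) auto

lemma dft_inversion:
  assumes N: "N > 0" and f: "f \<in> cyclic_vectors N"
  shows "f n = (\<Sum>j\<in>residues_mod N. dft N f j * omega N powi (j * n)) / of_nat N"
proof -
  have orth: "(\<Sum>j\<in>residues_mod N. omega N powi ((n - m) * j)) =
      (if m = n mod int N then of_nat N else 0)" if "m \<in> residues_mod N" for m
  proof -
    have "int N dvd n - m \<longleftrightarrow> m = n mod int N"
      using that by (auto simp: residues_mod_def mod_eq_dvd_iff[symmetric] dvd_diff_commute)
    moreover have "int N dvd n - m \<Longrightarrow> omega N powi ((n - m) * j) = 1" for j
      using N by (simp add: omega_powi_eq_1_iff)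
    moreover have "\<not> int N dvd n - m \<Longrightarrow> (\<Sum>j\<in>residues_mod N. omega N powi ((n - m) * j)) = 0"
      using sum_omega_powi_consecutive[of N "n - m" 0 N] N
        omega_powi_eq_1_iff[of N "(n - m) * int N"]
      by (simp add: residues_mod_def omega_powi_eq_1_iff)
    ultimately show ?thesis by auto
  qed
  have "(\<Sum>j\<in>residues_mod N. dft N f j * omega N powi (j * n)) =
      (\<Sum>j\<in>residues_mod N. \<Sum>m\<in>residues_mod N. f m * omega N powi ((n - m) * j))"
    unfolding dft_def sum_distrib_right
    by (intro sum.cong refl) (simp add: mult.assoc algebra_simps flip: omega_powi_add)
  also have "\<dots> = (\<Sum>m\<in>residues_mod N. f m * (\<Sum>j\<in>residues_mod N. omega N powi ((n - m) * j)))"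
    by (subst sum.swap) (simp add: sum_distrib_left)
  also have "\<dots> = (\<Sum>m\<in>residues_mod N. if m = n mod int N then f m * of_nat N else 0)"
    by (intro sum.cong refl) (simp add: orth)
  also have "\<dots> = f n * of_nat N"
    using N by (simp add: residues_mod_def sum.delta cyclic_vectors_mod[OF f])
  finally show ?thesis using N by simp
qed

text \<open>
  At consecutive points \<open>j + i\<close> the transform is a power sum of exponent \<open>i\<close> in the nodes
  \<open>\<omega>\<^sup>-\<^sup>a\<close>, where \<open>a\<close> ranges over the support of \<open>f\<close>; these nodes are distinct. With \<open>m = N\<close>
  this is the injectivity of the transform.
\<close>

lemma eq_0_if_dft_eq_0_on_window:
  assumes f: "f \<in> cyclic_vectors N" and m: "l0_norm N f \<le> m"
    and zero: "\<And>i. i < m \<Longrightarrow> dft N f (j + int i) = 0" and N: "N > 0"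
  shows "f n = 0"
proof -
  define I where "I = {n \<in> residues_mod N. f n \<noteq> 0}"
  have fin: "finite I" by (simp add: I_def)
  have "(\<Sum>a\<in>I. (f a * omega N powi (- (a * j))) * (omega N powi (- a)) ^ i) = 0" if "i < m" for i
  proof -
    have "(\<Sum>a\<in>I. (f a * omega N powi (- (a * j))) * (omega N powi (- a)) ^ i) =
        (\<Sum>a\<in>I. f a * omega N powi (- (a * (j + int i))))"
      by (intro sum.cong refl)
        (simp add: mult.assoc algebra_simps flip: omega_powi_add omega_powi_mult_nat)
    also have "\<dots> = dft N f (j + int i)"
      unfolding dft_def I_def by (rule sum.mono_neutral_left) auto
    finally show ?thesis using zero[OF that] by simp
  qed
  moreover have "card ((\<lambda>a. omega N powi (- a)) ` I) \<le> m"
    using m card_image_le[OF fin, of "\<lambda>a. omega N powi (- a)"] by (simp add: l0_norm_def I_def)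
  ultimately have fibre: "(\<Sum>a\<in>{a\<in>I. omega N powi (- a) = z}. f a * omega N powi (- (a * j))) = 0" for z
    by (intro fibre_sum_eq_0_if_power_sums_eq_0[OF fin]) auto
  have res: "f a = 0" if "a \<in> residues_mod N" for a
  proof (rule ccontr)
    assume "f a \<noteq> 0"
    moreover from this that have "{b\<in>I. omega N powi (- b) = omega N powi (- a)} = {a}"
      by (auto simp: I_def residues_mod_def dest!: omega_powi_inj[rotated])
    ultimately show False using fibre[of "omega N powi (- a)"] by simp
  qed
  have "n mod int N \<in> residues_mod N" using N by (simp add: residues_mod_def)
  from res[OF this] show ?thesis by (simp add: cyclic_vectors_mod[OF f])
qed

text \<open>
  As a function of \<open>j\<close> the product is an exponential sum whose frequencies are differences of elements
  of the support of \<open>x\<close>, which sparsity makes few.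
\<close>

lemma cnj_dft_mult_dft:
  "cnj (dft N x j) * dft N x (j + d) =
    (\<Sum>(a, b)\<in>residues_mod N \<times> residues_mod N.
      cnj (x a) * x b * omega N powi (- (b * d)) * omega N powi ((a - b) * j))"
  unfolding dft_def cnj_sum sum_product sum.cartesian_product
  by (intro sum.cong refl)
    (auto simp: cnj_omega_powi algebra_simps simp del: complex_cnj_power_int simp flip: omega_powi_add)

section \<open>Gabor measurements\<close>

lemma scalar_prod_gabor_interval:
  assumes N: "N > k" and g: "g \<in> cyclic_vectors N" "dft N g = interval_window N k"
  shows "scalar_prod N x (gabor N g (p, l)) =
    (\<Sum>b\<in>{0..int k}. omega N powi (- (p * b)) * cnj (dft N x (l + b))) / of_nat N"
proof -
  have sub: "{0..int k} \<subseteq> residues_mod N" using N by (auto simp: residues_mod_def)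
  have g_eq: "g n = (\<Sum>b\<in>{0..int k}. omega N powi (b * n)) / of_nat N" for n
  proof -
    have "(\<Sum>b\<in>residues_mod N. dft N g b * omega N powi (b * n)) =
        (\<Sum>b\<in>{0..int k}. dft N g b * omega N powi (b * n))"
      by (rule sum.mono_neutral_right[OF _ sub])
        (auto simp: g interval_window_def residues_mod_def)
    also have "\<dots> = (\<Sum>b\<in>{0..int k}. omega N powi (b * n))"
      using N by (intro sum.cong refl) (simp add: g interval_window_def)
    finally show ?thesis using dft_inversion[OF _ g(1), of n] N by simp
  qed
  have "scalar_prod N x (gabor N g (p, l)) * of_nat N =
      (\<Sum>n\<in>residues_mod N. \<Sum>b\<in>{0..int k}.
        omega N powi (- (p * b)) * cnj (x n * omega N powi (- (n * (l + b)))))"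
    using N unfolding scalar_prod_def gabor_def modulation_def translation_def g_eq
    by (simp add: sum_distrib_left sum_distrib_right sum_divide_distrib del: complex_cnj_power_int)
      (intro sum.cong refl, simp add: cnj_omega_powi algebra_simps del: complex_cnj_power_int flip: omega_powi_add)
  also have "\<dots> = (\<Sum>b\<in>{0..int k}. omega N powi (- (p * b)) * cnj (dft N x (l + b)))"
    by (subst sum.swap) (simp add: dft_def sum_distrib_left)
  finally show ?thesis using N by (simp add: field_simps)
qed

text \<open>
  The entry at \<open>l\<close> is a character summed over those \<open>b\<close> in \<open>{0..k}\<close> for which \<open>l + b\<close> lies in
  \<open>{0..k}\<close> modulo \<open>N\<close>. Because \<open>2k < N\<close>, overlap from the left (\<open>l\<close> near \<open>0\<close>) and from the
  right (\<open>l\<close> near \<open>N\<close>) cannot occur together, so these \<open>b\<close> form an interval.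
\<close>

lemma l0_norm_interval_autocorrelation:
  assumes N: "prime N" and k: "2 * k + 1 < N"
    and g: "g \<in> cyclic_vectors N" "dft N g = interval_window N k"
  shows "l0_norm N (\<lambda>l. scalar_prod N g (gabor N g (p, l))) = 2 * k + 1"
proof -
  define B where "B l = {b\<in>{0..int k}. (l + b) mod int N \<le> int k}" for l
  have N0: "N > 0" "N > k" using k by auto
  have eq: "scalar_prod N g (gabor N g (p, l)) = (\<Sum>b\<in>B l. omega N powi ((- p) * b)) / of_nat N" for l
    unfolding scalar_prod_gabor_interval[OF N0(2) g] g(2) B_def sum.inter_filter[OF finite_atLeastAtMost_int]
    using N0 by (intro arg_cong2[where f = "(/)"] sum.cong refl) (auto simp: interval_window_def)
  have nz: "(\<Sum>b\<in>{u..v}. omega N powi ((- p) * b)) \<noteq> 0" if "u \<le> v" "v - u \<le> int k" for u v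
    using sum_omega_powi_consecutive_neq_0[OF N, where r = "nat (v - u + 1)" and u = u and s = "- p"] that k
    by (simp add: atLeastLessThanPlusOne_atLeastAtMost_int)
  have "scalar_prod N g (gabor N g (p, l)) \<noteq> 0 \<longleftrightarrow> l \<in> {0..int k} \<union> {int N - int k..<int N}"
    if l: "l \<in> residues_mod N" for l
  proof -
    have wrap: "(l + b) mod int N = (if l + b < int N then l + b else l + b - int N)"
      if "b \<in> {0..int k}" for b
    proof (cases "l + b < int N")
      case False
      then have "(l + b) mod int N = (l + b - int N) mod int N" by simp
      also have "\<dots> = l + b - int N"
        using l that N0 False by (intro mod_pos_pos_trivial) (auto simp: residues_mod_def)
      finally show ?thesis using False by simp
    qed (use l that in \<open>simp add: residues_mod_def\<close>)
    consider "l \<le> int k" | "int k < l" "l < int N - int k" | "int N - int k \<le> l" by linarith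
    then show ?thesis
    proof cases
      case 1
      then have "B l = {0..int k - l}"
        using l k by (auto simp: B_def wrap residues_mod_def split: if_splits)
      then show ?thesis using nz[of 0 "int k - l"] 1 l N0 by (simp add: eq residues_mod_def)
    next
      case 2
      then have "B l = {}"
        using l k by (auto simp: B_def wrap residues_mod_def split: if_splits)
      then show ?thesis using 2 by (simp add: eq)
    next
      case 3
      then have "B l = {int N - l..int k}"
        using l k by (auto simp: B_def wrap residues_mod_def split: if_splits)
      then show ?thesis using nz[of "int N - l" "int k"] 3 l N0 by (simp add: eq residues_mod_def)
    qed
  qed
  moreover have "{0..int k} \<union> {int N - int k..<int N} \<subseteq> residues_mod N"
    using k by (auto simp: residues_mod_def)
  ultimately have "{l \<in> residues_mod N. scalar_prod N g (gabor N g (p, l)) \<noteq> 0} =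
      {0..int k} \<union> {int N - int k..<int N}"
    by blast
  then have "l0_norm N (\<lambda>l. scalar_prod N g (gabor N g (p, l))) =
      card ({0..int k} \<union> {int N - int k..<int N})"
    by (simp only: l0_norm_def)
  also have "\<dots> = 2 * k + 1" using k by (subst card_Un_disjoint) auto
  finally show ?thesis .
qed

section \<open>Phase retrieval\<close>

text \<open>
  The squared modulus is a trigonometric polynomial in \<open>p\<close> whose coefficient at frequency \<open>d\<close> is
  the lag-\<open>d\<close> autocorrelation of the window. Frequencies range over \<open>{-k..k}\<close>, which are distinct
  modulo \<open>N\<close>, so \<open>2k + 1\<close> sample points suffice.
\<close>

lemma window_correlations_eq:
  fixes X Y :: "int \<Rightarrow> complex"
  assumes k: "2 * k < N" and d: "d \<in> {0..int k}"
    and meas: "\<And>p. p \<in> {0..2 * int k} \<Longrightarrow>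
      cmod (\<Sum>b\<in>{0..int k}. omega N powi (- (p * b)) * cnj (X b)) =
      cmod (\<Sum>b\<in>{0..int k}. omega N powi (- (p * b)) * cnj (Y b))"
  shows "(\<Sum>b\<in>{0..int k - d}. cnj (X b) * X (b + d)) = (\<Sum>b\<in>{0..int k - d}. cnj (Y b) * Y (b + d))"
proof -
  let ?I = "{0..int k} \<times> {0..int k}"
  define c where "c = (\<lambda>(b, b'). cnj (X b) * X b' - cnj (Y b) * Y b')"
  define e where "e = (\<lambda>(b, b'). omega N powi (b' - b))"
  have square: "of_real ((cmod (\<Sum>b\<in>{0..int k}. omega N powi (- (p * b)) * cnj (Z b)))\<^sup>2) =
      (\<Sum>(b, b')\<in>?I. cnj (Z b) * Z b' * omega N powi ((b' - b) * p))" for p Z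
    unfolding complex_norm_square cnj_sum sum_product sum.cartesian_product
    by (intro sum.cong refl)
      (auto simp: cnj_omega_powi algebra_simps simp del: complex_cnj_power_int simp flip: omega_powi_add)
  have "(\<Sum>i\<in>?I. c i * e i ^ l) = 0" if "l < 2 * k + 1" for l
  proof -
    have "(\<Sum>i\<in>?I. c i * e i ^ l) =
        (\<Sum>(b, b')\<in>?I. cnj (X b) * X b' * omega N powi ((b' - b) * int l)) -
        (\<Sum>(b, b')\<in>?I. cnj (Y b) * Y b' * omega N powi ((b' - b) * int l))"
      unfolding sum_subtractf[symmetric]
      by (intro sum.cong refl) (auto simp: c_def e_def omega_powi_mult_nat left_diff_distrib[where ?'a = complex])
    also have "\<dots> = 0"
      unfolding square[symmetric] using meas[of "int l"] that by simp
    finally show ?thesis .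
  qed
  moreover have "card (e ` ?I) \<le> 2 * k + 1"
  proof -
    have "e ` ?I \<subseteq> (\<lambda>d. omega N powi d) ` {- int k..int k}"
      by (auto simp: e_def)
    then have "card (e ` ?I) \<le> card {- int k..int k}"
      by (rule surj_card_le[rotated]) simp
    then show ?thesis by simp
  qed
  ultimately have "(\<Sum>i\<in>{i\<in>?I. e i = omega N powi d}. c i) = 0"
    by (intro fibre_sum_eq_0_if_power_sums_eq_0) auto
  \<comment> \<open>Distinct lags in \<open>{-k..k}\<close> have distinct nodes, so a fibre contains the pairs of one lag only.\<close>
  moreover have "{i\<in>?I. e i = omega N powi d} = (\<lambda>b. (b, b + d)) ` {0..int k - d}"
  proof -
    have "b' = b + d" if "b \<in> {0..int k}" "b' \<in> {0..int k}" "omega N powi (b' - b) = omega N powi d" for b b'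
    proof -
      have "\<bar>(b' - b) - d\<bar> < int N" using that(1,2) d k by auto
      from omega_powi_inj[OF this that(3)] show ?thesis by simp
    qed
    then show ?thesis using d by (force simp: e_def)
  qed
  ultimately have "(\<Sum>b\<in>{0..int k - d}. c (b, b + d)) = 0"
    by (simp add: sum.reindex inj_on_def)
  then show ?thesis by (simp add: c_def sum_subtractf)
qed

text \<open>
  A moving sum of length \<open>r\<close> multiplies the coefficient of each character by the sum of its first
  \<open>r\<close> powers. For prime \<open>N\<close> and \<open>r < N\<close> these multipliers are non-zero, so no frequency is lost: if
  the moving sum has at least as many consecutive zeros as there are distinct frequencies, then
  every coefficient is zero after equal frequencies are collected.
\<close>

lemma exponential_sum_eq_0_if_window_sums_eq_0:
  assumes N: "prime N" and r: "0 < r" "r < N" and I: "finite I"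
    and card: "card ((\<lambda>i. omega N powi s i) ` I) \<le> m"
    and zero: "\<And>l. l \<in> {0..<int m} \<Longrightarrow>
      (\<Sum>b\<in>{0..<int r}. \<Sum>i\<in>I. c i * omega N powi (s i * (l + b))) = 0"
  shows "(\<Sum>i\<in>I. c i * omega N powi (s i * j)) = 0"
proof -
  define e where "e i = omega N powi s i" for i
  define G where "G z = (\<Sum>b\<in>{0..<int r}. z powi b)" for z :: complex
  have G: "G (e i) \<noteq> 0" for i
    using sum_omega_powi_consecutive_neq_0[OF N r, where u = 0 and s = "s i"]
    by (simp add: G_def e_def power_int_mult)
  have "(\<Sum>i\<in>I. (c i * G (e i)) * e i ^ l) = 0" if "l < m" for l
  proof -
    have "(\<Sum>i\<in>I. (c i * G (e i)) * e i ^ l) =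
        (\<Sum>i\<in>I. \<Sum>b\<in>{0..<int r}. c i * omega N powi (s i * (int l + b)))"
      by (simp add: G_def e_def sum_distrib_left sum_distrib_right ring_distribs omega_powi_add
        mult_ac flip: power_int_mult omega_powi_mult_nat)
    also have "\<dots> = 0" using zero[of "int l"] that by (subst sum.swap) simp
    finally show ?thesis .
  qed
  then have fibre: "(\<Sum>i\<in>{i\<in>I. e i = z}. c i * G (e i)) = 0" for z
    using card by (intro fibre_sum_eq_0_if_power_sums_eq_0[OF I]) (auto simp: e_def)
  have fibre': "(\<Sum>i\<in>{i\<in>I. e i = z}. c i) = 0" if z: "z \<in> e ` I" for z
  proof -
    have "(\<Sum>i\<in>{i\<in>I. e i = z}. c i) * G z = (\<Sum>i\<in>{i\<in>I. e i = z}. c i * G (e i))"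
      by (simp add: sum_distrib_right)
    then show ?thesis using fibre[of z] G z by auto
  qed
  have "(\<Sum>i\<in>I. c i * omega N powi (s i * j)) =
      (\<Sum>z\<in>e ` I. \<Sum>i\<in>{i\<in>I. e i = z}. c i * e i powi j)"
    using sum.group[OF I finite_imageI[OF I], of e e "\<lambda>i. c i * e i powi j"]
    by (simp add: e_def power_int_mult)
  also have "\<dots> = (\<Sum>z\<in>e ` I. (\<Sum>i\<in>{i\<in>I. e i = z}. c i) * z powi j)"
    by (simp add: sum_distrib_right)
  also have "\<dots> = 0" by (simp add: fibre')
  finally show ?thesis .
qed

text \<open>
  The difference of the two sides is an exponential sum in \<open>j\<close> with frequencies \<open>a - b\<close>, where
  \<open>a\<close> and \<open>b\<close> both lie in the support of \<open>x\<close> or both lie in that of \<open>y\<close>. There are at most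
  \<open>k\<^sup>2 + k\<^sup>2\<close> such pairs, and at most \<open>N\<close> differences modulo \<open>N\<close>.
\<close>

lemma sparse_correlations_eq:
  assumes N: "prime N" and k: "k + 1 < N" and d: "d \<in> {0..int k}"
    and x: "l0_norm N x \<le> k" and y: "l0_norm N y \<le> k"
    and m: "min (2 * k\<^sup>2) N \<le> m"
    and win: "\<And>l. l \<in> {0..<int m} \<Longrightarrow>
      (\<Sum>b\<in>{0..int k - d}. cnj (dft N x (l + b)) * dft N x (l + b + d)) =
      (\<Sum>b\<in>{0..int k - d}. cnj (dft N y (l + b)) * dft N y (l + b + d))"
  shows "cnj (dft N x j) * dft N x (j + d) = cnj (dft N y j) * dft N y (j + d)"
proof -
  define S where "S f = {n \<in> residues_mod N. f n \<noteq> 0}" for f :: "int \<Rightarrow> complex"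
  define I where "I = S x \<times> S x \<union> S y \<times> S y"
  define c where "c = (\<lambda>(a, b). (cnj (x a) * x b - cnj (y a) * y b) * omega N powi (- (b * d)))"
  define s where "s = (\<lambda>(a, b). a - b :: int)"
  have finS: "finite (S f)" for f by (simp add: S_def)
  have fin: "finite I" by (simp add: I_def finS)
  have sum_eq: "cnj (dft N x j) * dft N x (j + d) - cnj (dft N y j) * dft N y (j + d) =
      (\<Sum>i\<in>I. c i * omega N powi (s i * j))" for j
  proof -
    have "cnj (dft N x j) * dft N x (j + d) - cnj (dft N y j) * dft N y (j + d) =
        (\<Sum>i\<in>residues_mod N \<times> residues_mod N. c i * omega N powi (s i * j))"
      unfolding cnj_dft_mult_dft sum_subtractf[symmetric]
      by (intro sum.cong refl) (auto simp: c_def s_def left_diff_distrib)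
    also have "\<dots> = (\<Sum>i\<in>I. c i * omega N powi (s i * j))"
      by (rule sum.mono_neutral_right) (auto simp: I_def S_def c_def)
    finally show ?thesis .
  qed
  have "card I \<le> card (S x) * card (S x) + card (S y) * card (S y)"
    unfolding I_def by (rule order_trans[OF card_Un_le]) (simp add: card_cartesian_product)
  also have "\<dots> \<le> k * k + k * k"
    using x y unfolding l0_norm_def S_def[symmetric] by (intro add_mono mult_mono) auto
  finally have "card ((\<lambda>i. omega N powi s i) ` I) \<le> 2 * k\<^sup>2"
    using card_image_le[OF fin, of "\<lambda>i. omega N powi s i"] by (simp add: power2_eq_square)
  moreover have "card ((\<lambda>i. omega N powi s i) ` I) \<le> N"
  proof -
    have "omega N powi t \<in> (\<lambda>t. omega N powi t) ` residues_mod N" for t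
      using k by (intro image_eqI[of _ _ "t mod int N"])
        (auto simp: omega_powi_eq_iff residues_mod_def minus_mod_eq_mult_div)
    then have "(\<lambda>i. omega N powi s i) ` I \<subseteq> (\<lambda>t. omega N powi t) ` residues_mod N" by auto
    then show ?thesis using surj_card_le[OF finite_residues_mod[of N]] by simp
  qed
  ultimately have card: "card ((\<lambda>i. omega N powi s i) ` I) \<le> m" using m by linarith
  define r where "r = nat (int k - d + 1)"
  have r: "0 < r" "r < N" using d k by (auto simp: r_def)
  have rng: "{0..int k - d} = {0..<int r}" using d by (auto simp: r_def)
  have "(\<Sum>i\<in>I. c i * omega N powi (s i * j)) = 0"
  proof (rule exponential_sum_eq_0_if_window_sums_eq_0[OF N r fin card])
    fix l assume "l \<in> {0..<int m}"
    from win[OF this] show "(\<Sum>b\<in>{0..<int r}. \<Sum>i\<in>I. c i * omega N powi (s i * (l + b))) = 0"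
      by (simp add: rng sum_subtractf flip: sum_eq)
  qed
  then show ?thesis using sum_eq[of j] by simp
qed

text \<open>
  The lag \<open>0\<close> correlations give equal moduli, so the ratio of \<open>X\<close> and \<open>Y\<close> at one non-zero point of
  \<open>X\<close> is unimodular. Going upwards, every further point has a non-zero point of \<open>X\<close> at
  distance at most \<open>k\<close> below it, and the correlation of the two transports the ratio.
\<close>

lemma phase_propagation:
  fixes X Y :: "int \<Rightarrow> complex"
  assumes corr: "\<And>j d. d \<in> {0..int k} \<Longrightarrow> cnj (X j) * X (j + d) = cnj (Y j) * Y (j + d)"
    and gap: "\<And>j. \<exists>i<k. X (j + int i) \<noteq> 0"
  obtains c j0 where "cmod c = 1" "\<And>j. j \<ge> j0 \<Longrightarrow> X j = c * Y j"
proof -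
  have norm_eq: "cmod (X j) = cmod (Y j)" for j
  proof -
    have "complex_of_real ((cmod (X j))\<^sup>2) = of_real ((cmod (Y j))\<^sup>2)"
      using corr[of 0 j] unfolding complex_norm_square by (simp add: mult.commute)
    then show ?thesis by (simp flip: of_real_power)
  qed
  obtain i0 where "X (0 + int i0) \<noteq> 0" using gap by blast
  then obtain j0 where j0: "X j0 \<noteq> 0" by blast
  have Y0: "Y j0 \<noteq> 0" using j0 norm_eq[of j0] by auto
  define c where "c = X j0 / Y j0"
  have c: "cmod c = 1" using Y0 by (simp add: c_def norm_divide norm_eq)
  have cc: "cnj c * c = 1" using c by (simp add: complex_norm_square[symmetric] mult.commute[of "cnj c"])
  have "X j = c * Y j" if "j \<ge> j0" for j
    using that
  proof (induction "nat (j - j0)" arbitrary: j rule: less_induct)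
    case less
    show ?case
    proof (cases "j = j0")
      case True
      then show ?thesis using Y0 by (simp add: c_def)
    next
      case False
      obtain j' where j': "j0 \<le> j'" "j' < j" "j - j' \<le> int k" "X j' \<noteq> 0"
      proof (cases "j - int k \<ge> j0")
        case True
        obtain i where "i < k" "X (j - int k + int i) \<noteq> 0" using gap by blast
        then show ?thesis using True by (intro that[of "j - int k + int i"]) auto
      next
        case f: False
        then show ?thesis using less.prems False j0 by (intro that[of j0]) auto
      qed
      have IH: "X j' = c * Y j'" using j' by (intro less.hyps) auto
      have "cnj (X j') * X j = cnj (Y j') * Y j"
        using corr[of "j - j'" j'] j' by simp
      also have "cnj (Y j') = c * cnj (X j')" unfolding IH using cc by (simp add: mult.commute[of c])
      finally have "cnj (X j') * X j = cnj (X j') * (c * Y j)" by simp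
      then show ?thesis using j'(4) by simp
    qed
  qed
  then show ?thesis using that c by blast
qed

theorem proposition3p1:
  fixes N k :: nat and g :: "int \<Rightarrow> complex"
  assumes "prime N"
    and "k \<ge> 1"
    and "2 * k + 1 < N"
    and "g \<in> cyclic_vectors N"
    and "dft N g = interval_window N k"
  shows "(\<forall>p\<in>residues_mod N.
            2 * k \<le> l0_norm N (\<lambda>l. scalar_prod N g (gabor N g (p, l))) \<and>
            l0_norm N (\<lambda>l. scalar_prod N g (gabor N g (p, l))) \<le> 2 * k + 1) \<and>
         (\<exists>\<Lambda> \<subseteq> residues_mod N \<times> residues_mod N.
            card \<Lambda> = (2 * k + 1) * min (4 * k^2 - 2 * k + 1) N \<and>
            does_sparse_phase_retrieval N k (gabor N g) \<Lambda>)"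
proof -
  define m where "m = min (4 * k^2 - 2 * k + 1) N"
  define \<Lambda> where "\<Lambda> = {0..2 * int k} \<times> {0..<int m}"
  have N0: "N > 0" "N > k" "k + 1 < N" "2 * k < N" using assms(3) by auto
  have m: "min (2 * k\<^sup>2) N \<le> m"
  proof -
    have "2 * k \<le> 2 * k\<^sup>2" using assms(2) by (simp add: power2_eq_square)
    then have "2 * k\<^sup>2 \<le> 4 * k^2 - 2 * k + 1" by linarith
    then show ?thesis by (auto simp: m_def)
  qed
  have sub: "\<Lambda> \<subseteq> residues_mod N \<times> residues_mod N"
    using assms(3) by (auto simp: \<Lambda>_def m_def residues_mod_def)
  have card: "card \<Lambda> = (2 * k + 1) * min (4 * k^2 - 2 * k + 1) N"
    by (simp add: \<Lambda>_def m_def card_cartesian_product nat_add_distrib nat_mult_distrib)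
  have "does_sparse_phase_retrieval N k (gabor N g) \<Lambda>"
    unfolding does_sparse_phase_retrieval_def
  proof (intro ballI impI)
    fix x y
    assume x: "x \<in> sparse_vectors N k" and y: "y \<in> sparse_vectors N k"
      and meas: "\<forall>i\<in>\<Lambda>. cmod (scalar_prod N x (gabor N g i)) = cmod (scalar_prod N y (gabor N g i))"
    have x': "x \<in> cyclic_vectors N" "l0_norm N x \<le> k"
      and y': "y \<in> cyclic_vectors N" "l0_norm N y \<le> k"
      using x y by (auto simp: sparse_vectors_def)
    have corr: "cnj (dft N x j) * dft N x (j + d) = cnj (dft N y j) * dft N y (j + d)"
      if d: "d \<in> {0..int k}" for j d
    proof (rule sparse_correlations_eq[OF assms(1) N0(3) d x'(2) y'(2) m])
      fix l assume l: "l \<in> {0..<int m}"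
      have "cmod (\<Sum>b\<in>{0..int k}. omega N powi (- (p * b)) * cnj (dft N x (l + b))) =
          cmod (\<Sum>b\<in>{0..int k}. omega N powi (- (p * b)) * cnj (dft N y (l + b)))"
        if "p \<in> {0..2 * int k}" for p
        using meas[rule_format, of "(p, l)"] that l N0
        by (simp add: \<Lambda>_def scalar_prod_gabor_interval[OF N0(2) assms(4,5)] norm_divide)
      then show "(\<Sum>b\<in>{0..int k - d}. cnj (dft N x (l + b)) * dft N x (l + b + d)) =
          (\<Sum>b\<in>{0..int k - d}. cnj (dft N y (l + b)) * dft N y (l + b + d))"
        using window_correlations_eq[OF N0(4) d, of "\<lambda>b. dft N x (l + b)" "\<lambda>b. dft N y (l + b)"]
        by (simp add: add.assoc)
    qed
    \<comment> \<open>If \<open>X\<close> has \<open>k\<close> consecutive zeros, so has \<open>Y\<close> by the lag \<open>0\<close> correlations, and both vectors vanish.\<close>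
    show "\<exists>c. cmod c = 1 \<and> x = (\<lambda>n. c * y n)"
    proof (cases "\<exists>j. \<forall>i<k. dft N x (j + int i) = 0")
      case True
      then obtain j where j: "\<And>i. i < k \<Longrightarrow> dft N x (j + int i) = 0" by blast
      moreover have "dft N y (j + int i) = 0" if "i < k" for i
        using corr[of 0 "j + int i"] j[OF that] by simp
      ultimately have "x n = 0" "y n = 0" for n
        using eq_0_if_dft_eq_0_on_window[OF x' _ N0(1)] eq_0_if_dft_eq_0_on_window[OF y' _ N0(1)]
        by blast+
      then show ?thesis by (intro exI[of _ 1]) auto
    next
      case False
      then obtain c j0 where c: "cmod c = 1" "\<And>j. j \<ge> j0 \<Longrightarrow> dft N x j = c * dft N y j"
        using phase_propagation[OF corr] by metis
      define f where "f n = x n - c * y n" for n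
      have f: "f \<in> cyclic_vectors N" using x' y' by (simp add: f_def cyclic_vectors_def)
      have dft_f: "dft N f j = dft N x j - c * dft N y j" for j
        by (simp add: dft_def f_def left_diff_distrib sum_subtractf sum_distrib_left mult.assoc)
      \<comment> \<open>\<open>X = c * Y\<close> is known only from \<open>j0\<close> on, but \<open>N\<close> consecutive points determine a vector.\<close>
      have "f n = 0" for n
        by (rule eq_0_if_dft_eq_0_on_window[OF f l0_norm_le _ N0(1), of j0]) (simp add: dft_f c)
      then show ?thesis using c(1) by (intro exI[of _ c]) (auto simp: f_def)
    qed
  qed
  then show ?thesis
    using sub card l0_norm_interval_autocorrelation[OF assms(1,3,4,5)] by auto
qed

end
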